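(* Let $X$ be a path-connected space and let $Y$ be a hereditarily indecomposable continuum. Then $X$ is incomparable with $Y$, i.e. every continuous mapping $f\colon X\to Y$ is constant. In particular, when $X$ is a metric space and $Y$ is endowed with a metric generating its topology, $2d_{GH}^c(X,Y)\ge\operatorname{diam} X$.
   Context: All spaces are non-empty. A continuum is a connected compact metrizable space (a metric space in this setting); a subcontinuum is a subset that is a continuum. A continuum is hereditarily indecomposable if none of its subcontinua $Z$ can be represented as the union of two proper (non-empty and distinct from $Z$) subcontinua. In a metric space $|xx'|$ denotes the distance between points $x,x'$ and $\operatorname{diam} X=\sup_{x,x'\in X}|xx'|\in[0,\infty]$. For maps $f\colon X\to Y$ and $g\colon Y\to X$ between metric spaces put $$\operatorname{dis} f=\sup_{x,x'\in X}\bigl||xx'|-|f(x)f(x')|\bigr|,\qquad \operatorname{codis}(f,g)=\sup_{x\in X,\,y\in Y}\bigl||x\,g(y)|-|f(x)\,y|\bigr|$$ ($\operatorname{dis} g$ is defined analogously). The continuous Gromov--Hausdorff distance is $d^c_{GH}(X,Y)=\frac12\inf\max\{\operatorname{dis} f,\operatorname{dis} g,\operatorname{codis}(f,g)\}\in[0,\infty]$, the infimum being over all continuous maps $f\colon X\to Y$ and $g\colon Y\to X$. *)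

theory Defs
  imports "HOL-Analysis.Analysis"
begin

section \<open>Continua\<close>

definition continuum_space :: "'a topology \<Rightarrow> bool" where
  "continuum_space X \<longleftrightarrow>
     topspace X \<noteq> {} \<and> connected_space X \<and> compact_space X \<and> metrizable_space X"

definition subcontinuum :: "'a topology \<Rightarrow> 'a set \<Rightarrow> bool" where
  "subcontinuum X Z \<longleftrightarrow> Z \<subseteq> topspace X \<and> continuum_space (subtopology X Z)"

text \<open>Non-emptiness of the two pieces is part of \<^const>\<open>subcontinuum\<close>.\<close>

definition decomposable :: "'a topology \<Rightarrow> bool" where
  "decomposable X \<longleftrightarrow>
     (\<exists>A B. subcontinuum X A \<and> A \<noteq> topspace X \<and>
            subcontinuum X B \<and> B \<noteq> topspace X \<and> topspace X = A \<union> B)"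

definition hereditarily_indecomposable_continuum :: "'a topology \<Rightarrow> bool" where
  "hereditarily_indecomposable_continuum X \<longleftrightarrow>
     continuum_space X \<and> (\<forall>Z. subcontinuum X Z \<longrightarrow> \<not> decomposable (subtopology X Z))"

text \<open>The relation is not symmetric in \<open>X\<close> and \<open>Y\<close>.\<close>

definition incomparable_with :: "'a topology \<Rightarrow> 'b topology \<Rightarrow> bool" where
  "incomparable_with X Y \<longleftrightarrow> (\<forall>f. continuous_map X Y f \<longrightarrow> f constant_on topspace X)"


section \<open>The continuous Gromov--Hausdorff distance\<close>

text \<open>
  All quantities below lie in \<open>[0, \<infinity>]\<close> and may be infinite, so suprema and infima are
  taken in \<^typ>\<open>ennreal\<close>, where they always exist.
\<close>

definition mdiam :: "'a metric \<Rightarrow> ennreal" where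
  "mdiam X = (SUP x\<in>mspace X. SUP x'\<in>mspace X. ennreal (mdist X x x'))"

definition distortion :: "'a metric \<Rightarrow> 'b metric \<Rightarrow> ('a \<Rightarrow> 'b) \<Rightarrow> ennreal" where
  "distortion X Y f =
     (SUP x\<in>mspace X. SUP x'\<in>mspace X. ennreal \<bar>mdist X x x' - mdist Y (f x) (f x')\<bar>)"

definition codistortion ::
  "'a metric \<Rightarrow> 'b metric \<Rightarrow> ('a \<Rightarrow> 'b) \<Rightarrow> ('b \<Rightarrow> 'a) \<Rightarrow> ennreal" where
  "codistortion X Y f g =
     (SUP x\<in>mspace X. SUP y\<in>mspace Y. ennreal \<bar>mdist X x (g y) - mdist Y (f x) y\<bar>)"

definition continuous_GH_dist :: "'a metric \<Rightarrow> 'b metric \<Rightarrow> ennreal" where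
  "continuous_GH_dist X Y =
     1 / 2 * (INF (f, g) \<in> {(f, g). continuous_map (mtopology_of X) (mtopology_of Y) f \<and>
                                    continuous_map (mtopology_of Y) (mtopology_of X) g}.
                max (max (distortion X Y f) (distortion Y X g)) (codistortion X Y f g))"

end

theory Submission
  imports Defs
begin

text \<open>
  In a hereditarily indecomposable continuum two intersecting subcontinua are nested. Hence for a
  path \<open>g\<close> the image of \<open>[a,c]\<close> equals the image of \<open>[a,b]\<close> or of \<open>[b,c]\<close>, and bisection shows
  that the image of the whole path is as small as that of some arbitrarily short interval.
  A constant map from \<open>X\<close> has distortion \<open>diam X\<close>, which gives the metric bound.
\<close>

lemma subcontinuum_Un:
  assumes "metrizable_space Y" "subcontinuum Y A" "subcontinuum Y B" "A \<inter> B \<noteq> {}"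
  shows "subcontinuum Y (A \<union> B)"
proof -
  have "connectedin Y A" "connectedin Y B" "compactin Y A" "compactin Y B"
    using assms
    by (auto simp: subcontinuum_def continuum_space_def connectedin_def compactin_subspace)
  then have "connectedin Y (A \<union> B)" "compactin Y (A \<union> B)"
    using assms(4) by (auto intro: connectedin_Un compactin_Un)
  with assms show ?thesis
    by (auto simp: subcontinuum_def continuum_space_def connectedin_def compactin_subspace
        metrizable_space_subtopology)
qed

lemma subcontinuum_image:
  assumes "continuous_map X Y f" "compactin X S" "connectedin X S" "S \<noteq> {}" "metrizable_space Y"
  shows "subcontinuum Y (f ` S)"
  using image_compactin[OF assms(2,1)] connectedin_continuous_map_image[OF assms(1,3)] assms(4,5)
  by (auto simp: subcontinuum_def continuum_space_def connectedin_def compactin_subspace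
      metrizable_space_subtopology)

text \<open>Otherwise \<open>A\<close> and \<open>B\<close> would both be proper in
  \<open>A \<union> B\<close>, which is a subcontinuum because the two pieces meet, and so they
  would decompose it.\<close>

lemma hereditarily_indecomposable_nested:
  assumes "hereditarily_indecomposable_continuum Y"
    and "subcontinuum Y A" "subcontinuum Y B" "A \<inter> B \<noteq> {}"
  shows "A \<subseteq> B \<or> B \<subseteq> A"
proof (rule ccontr)
  assume nested: "\<not> (A \<subseteq> B \<or> B \<subseteq> A)"
  have un: "subcontinuum Y (A \<union> B)"
    using assms by (intro subcontinuum_Un)
      (auto simp: hereditarily_indecomposable_continuum_def continuum_space_def)
  have "topspace (subtopology Y (A \<union> B)) = A \<union> B"
    using un by (auto simp: subcontinuum_def)
  moreover have "subcontinuum (subtopology Y (A \<union> B)) A" "subcontinuum (subtopology Y (A \<union> B)) B"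
    using assms(2,3)
    by (auto simp: subcontinuum_def subtopology_subtopology Int_absorb1 Int_absorb2 Un_Int_distrib2)
  ultimately have "decomposable (subtopology Y (A \<union> B))"
    using nested unfolding decomposable_def by (intro exI[of _ A] exI[of _ B]) auto
  with un assms(1) show False
    by (auto simp: hereditarily_indecomposable_continuum_def)
qed

lemma path_in_hereditarily_indecomposable_continuum:
  assumes hi: "hereditarily_indecomposable_continuum Y" and g: "pathin Y g"
  shows "g 0 = g 1"
proof (rule ccontr)
  assume ne: "g 0 \<noteq> g 1"
  have met: "metrizable_space Y"
    using hi by (auto simp: hereditarily_indecomposable_continuum_def continuum_space_def)
  have cont: "continuous_map (top_of_set {0..1}) Y g"
    using g by (simp add: pathin_def)
  \<comment> \<open>Bisection is run on the negative property that the image of the interval misses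
    an endpoint value, so that \<open>P 0 1\<close> is absurd. The guard makes \<open>P\<close>
    trivially true for intervals leaving \<open>[0,1]\<close>, since \<open>Bolzano\<close>
    quantifies over all real endpoints.\<close>
  define P where "P a b \<longleftrightarrow> 0 \<le> a \<and> b \<le> 1 \<longrightarrow> \<not> {g 0, g 1} \<subseteq> g ` {a..b}" for a b :: real
  have sub: "subcontinuum Y (g ` {a..b})" if "0 \<le> a" "a \<le> b" "b \<le> 1" for a b
    using that by (intro subcontinuum_image[OF cont _ _ _ met])
      (auto simp: compactin_subtopology connectedin_subtopology)
  have "P 0 1"
  proof (rule Bolzano)
    fix a b c :: real
    assume P: "P a b" "P b c" and le: "a \<le> b" "b \<le> c"
    show "P a c"
      unfolding P_def
    proof
      assume ac: "0 \<le> a \<and> c \<le> 1"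
      have "b \<in> {a..b}" "b \<in> {b..c}"
        using le by auto
      then have "g b \<in> g ` {a..b} \<inter> g ` {b..c}"
        by (intro IntI imageI)
      then have "g ` {a..b} \<inter> g ` {b..c} \<noteq> {}"
        by blast
      moreover have "subcontinuum Y (g ` {a..b})" "subcontinuum Y (g ` {b..c})"
        using le ac by (auto intro!: sub)
      ultimately have "g ` {a..b} \<subseteq> g ` {b..c} \<or> g ` {b..c} \<subseteq> g ` {a..b}"
        using hereditarily_indecomposable_nested[OF hi] by metis
      moreover have "g ` {a..c} = g ` {a..b} \<union> g ` {b..c}"
        using le by (simp flip: image_Un add: ivl_disj_un_two_touch)
      \<comment> \<open>Nestedness lets the larger piece absorb the other, so the endpoint value
        missed by that piece is missed on all of \<open>[a,c]\<close>.\<close>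
      ultimately have "g ` {a..c} = g ` {a..b} \<or> g ` {a..c} = g ` {b..c}"
        by blast
      then show "\<not> {g 0, g 1} \<subseteq> g ` {a..c}"
        using P le ac unfolding P_def by (elim disjE) simp_all
    qed
  next
    fix x :: real
    assume x: "0 \<le> x" "x \<le> 1"
    \<comment> \<open>As \<open>g 0\<close> and \<open>g 1\<close> differ, \<open>g x\<close> avoids
      at least one of them; by continuity this value \<open>e\<close> is avoided near
      \<open>x\<close> too.\<close>
    obtain e where e: "e \<in> {g 0, g 1}" "g x \<noteq> e"
      using ne by (metis insertCI)
    have "e \<in> topspace Y"
      using e(1) continuous_map_image_subset_topspace[OF cont] by auto
    then have "closedin Y {e}"
      using met by (simp add: closedin_t1_singleton metrizable_imp_t1_space)
    then have "closedin (top_of_set {0..1}) {t \<in> {0..1}. g t \<in> {e}}"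
      using closedin_continuous_map_preimage[OF cont, of "{e}"] by simp
    \<comment> \<open>Closedness passes from \<open>[0,1]\<close> to the real line, so that
      \<open>d\<close> is an ordinary radius around \<open>x\<close>, even when \<open>x\<close> is
      0 or 1.\<close>
    then have "closed {t \<in> {0..1}. g t = e}"
      using closedin_closed_trans[of "{0..1::real}"] by simp
    then have "open (- {t \<in> {0..1}. g t = e})"
      by auto
    then obtain d where d: "d > 0" "\<And>t. \<bar>t - x\<bar> < d \<Longrightarrow> \<not> (t \<in> {0..1} \<and> g t = e)"
      using e(2) unfolding open_dist by (auto simp: dist_real_def)
    have "P a b" if "a \<le> x" "x \<le> b" "b - a < d" for a b
      unfolding P_def
    proof (intro impI notI)
      assume ab: "0 \<le> a \<and> b \<le> 1" and "{g 0, g 1} \<subseteq> g ` {a..b}"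
      then obtain t where "t \<in> {a..b}" "g t = e"
        using e(1) by auto
      moreover from this have "\<bar>t - x\<bar> < d"
        using that by auto
      ultimately show False
        using d(2)[of t] ab by auto
    qed
    then show "\<exists>d>0. \<forall>a b. a \<le> x \<and> x \<le> b \<and> b - a < d \<longrightarrow> P a b"
      using d(1) by blast
  qed simp
  then show False
    by (auto simp: P_def)
qed

text \<open>A continuous map carries a path joining two points to a path in \<open>Y\<close>, whose
  ends coincide.\<close>

lemma path_connected_incomparable_with:
  assumes "path_connected_space X" "hereditarily_indecomposable_continuum Y"
  shows "incomparable_with X Y"
  unfolding incomparable_with_def
proof (intro allI impI)
  fix f
  assume f: "continuous_map X Y f"
  have "f x = f y" if xy: "x \<in> topspace X" "y \<in> topspace X" for x y
  proof -
    obtain g where g: "pathin X g" "g 0 = x" "g 1 = y"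
      using assms(1) xy unfolding path_connected_space_def by metis
    then have "pathin Y (f \<circ> g)"
      using f by (auto simp: pathin_def intro: continuous_map_compose)
    from path_in_hereditarily_indecomposable_continuum[OF assms(2) this] g show ?thesis
      by simp
  qed
  then show "f constant_on topspace X"
    unfolding constant_on_def by blast
qed

lemma distortion_constant_on:
  assumes "f constant_on mspace X" "f ` mspace X \<subseteq> mspace Y"
  shows "distortion X Y f = mdiam X"
  unfolding distortion_def mdiam_def
proof (intro SUP_cong refl)
  fix x x'
  assume x: "x \<in> mspace X" "x' \<in> mspace X"
  then have "f x = f x'" "f x \<in> mspace Y" "f x' \<in> mspace Y"
    using assms by (auto simp: constant_on_def)
  then have "mdist Y (f x) (f x') = 0"
    by simp
  then show "ennreal \<bar>mdist X x x' - mdist Y (f x) (f x')\<bar> = ennreal (mdist X x x')"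
    by simp
qed

text \<open>Every admissible \<open>f\<close> is constant, so for each pair \<open>(f, g)\<close>
  the first entry of the maximum already equals \<open>mdiam X\<close>, whatever \<open>g\<close>
  is.\<close>

lemma mdiam_le_continuous_GH_dist:
  assumes "incomparable_with (mtopology_of X) (mtopology_of Y)"
  shows "mdiam X \<le> 2 * continuous_GH_dist X Y"
proof -
  \<comment> \<open>The cancellation covers \<open>c = \<infinity>\<close> as well, since the factor
    2 is neither 0 nor infinite.\<close>
  have half: "2 * (1 / 2 * c) = c" for c :: ennreal
    using mult_divide_eq_ennreal[of 2 c]
    by (simp add: ennreal_divide_times ennreal_times_divide mult.commute)
  have "mdiam X \<le> max (max (distortion X Y f) (distortion Y X g)) (codistortion X Y f g)"
    if "continuous_map (mtopology_of X) (mtopology_of Y) f" for f g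
  proof -
    have "distortion X Y f = mdiam X"
      using that assms continuous_map_image_subset_topspace[OF that]
      by (intro distortion_constant_on) (auto simp: incomparable_with_def)
    then show ?thesis
      by (simp add: le_max_iff_disj)
  qed
  then show ?thesis
    unfolding continuous_GH_dist_def half by (auto intro!: INF_greatest)
qed

theorem proposition8p5:
  fixes X :: "'a topology" and Y :: "'b topology"
  assumes "topspace X \<noteq> {}"
    and "path_connected_space X"
    and "hereditarily_indecomposable_continuum Y"
  shows "incomparable_with X Y \<and>
         (\<forall>(mX :: 'a metric) (mY :: 'b metric).
            mtopology_of mX = X \<and> mtopology_of mY = Y \<longrightarrow>
            2 * continuous_GH_dist mX mY \<ge> mdiam mX)"
  using path_connected_incomparable_with[OF assms(2,3)] mdiam_le_continuous_GH_dist by auto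

end
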